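(* Let $n\ge 2$, $m\in\{1,\dots,n-1\}$, $\sigma\in(0,1)$, and let $\Sigma$ be an $n\times n$ symmetric positive-definite matrix. Let $G_o=\mathcal{N}(0,\Sigma)$ and $G^{(1)}_{\mathrm{SSL}}=\mathcal{N}(0,\sigma\Sigma)$. For $\alpha>\beta>0$ satisfying $\alpha^m\beta^{n-m}=\sigma^n$, let $D=\mathrm{diag}(\alpha,\dots,\alpha,\beta,\dots,\beta)$ ($m$ entries $\alpha$, $n-m$ entries $\beta$) and $G_{\mathrm{SL}}=\mathcal{N}(0,\Sigma^{1/2}D\Sigma^{1/2})$. Then $$D_{\mathrm{KL}}(G_o\|G_{\mathrm{SL}})\ge D_{\mathrm{KL}}(G_o\|G^{(1)}_{\mathrm{SSL}}),$$ with equality iff $\alpha=\beta=\sigma$. Moreover, as $\beta\to 0$ with $\alpha$ determined by $\alpha^m\beta^{n-m}=\sigma^n$, $$\frac{D_{\mathrm{KL}}(G_o\|G_{\mathrm{SL}})}{D_{\mathrm{KL}}(G_o\|G^{(1)}_{\mathrm{SSL}})}\to\infty.$$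
   Context: $D_{\mathrm{KL}}$ denotes Kullback–Leibler divergence; $\Sigma^{1/2}$ is the symmetric positive-definite square root of $\Sigma$. The constraint $\alpha^m\beta^{n-m}=\sigma^n$ is equivalent to $\det(\Sigma^{1/2}D\Sigma^{1/2})=\det(\sigma\Sigma)$ (equal covariance-ellipsoid volume). *)

theory Defs
  imports "HOL-Analysis.Analysis" "HOL-Probability.Probability"
begin

text \<open>Symmetric positive-definite matrices over an index type 'n.\<close>
definition sym_posdef :: "real^'n^'n \<Rightarrow> bool" where
  "sym_posdef A \<longleftrightarrow> transpose A = A \<and> (\<forall>x. x \<noteq> 0 \<longrightarrow> x \<bullet> (A *v x) > 0)"

text \<open>The symmetric positive-definite square root.\<close>
definition mat_sqrt :: "real^'n^'n \<Rightarrow> real^'n^'n" where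
  "mat_sqrt A = (THE S. sym_posdef S \<and> S ** S = A)"

text \<open>Diagonal matrix with diagonal d.\<close>
definition diag_mat :: "(real^'n) \<Rightarrow> real^'n^'n" where
  "diag_mat d = (\<chi> i j. if i = j then d $ i else 0)"

text \<open>Density of the centred Gaussian N(0,S) on real^'n w.r.t. Lebesgue measure.\<close>
definition gauss_density :: "real^'n^'n \<Rightarrow> real^'n \<Rightarrow> real" where
  "gauss_density S x =
     exp (- (x \<bullet> (matrix_inv S *v x)) / 2) / sqrt ((2 * pi) ^ CARD('n) * det S)"

definition gaussian :: "real^'n^'n \<Rightarrow> (real^'n) measure" where
  "gaussian S = density lborel (\<lambda>x. ennreal (gauss_density S x))"

text \<open>D_KL(P || Q) (natural log): Isabelle's KL_divergence b M N integrates log(dN/dM) over N.\<close>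
definition KL :: "'a measure \<Rightarrow> 'a measure \<Rightarrow> real" where
  "KL P Q = KL_divergence (exp 1) Q P"

text \<open>The matrix D = diag(alpha,..,alpha,beta,..,beta): the first m indices (w.r.t. the
  linear order on the index type) carry alpha.\<close>
definition D_mat :: "nat \<Rightarrow> real \<Rightarrow> real \<Rightarrow> real^('n::{finite,linorder})^('n::{finite,linorder})" where
  "D_mat m \<alpha> \<beta> = diag_mat (\<chi> i. if card {j. j < i} < m then \<alpha> else \<beta>)"

end

theory Submission
  imports Defs
begin

text \<open>Write \<open>S\<close> for the square root of \<open>\<Sigma>\<close>. All covariances involved have the form
  \<open>S D S\<close> with \<open>D = diag d\<close> (for \<open>\<sigma> \<Sigma>\<close> take \<open>D = \<sigma> I\<close>), and for these
  \<open>KL(N(0,\<Sigma>) || N(0,S D S)) = (\<Sum>i. 1/d\<^sub>i - 1 + ln d\<^sub>i) / 2\<close>, since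
  \<open>tr((S D S)\<^sup>-\<^sup>1 \<Sigma>) = tr(D\<^sup>-\<^sup>1)\<close> and \<open>det(S D S) = det \<Sigma> \<Prod>i. d\<^sub>i\<close>.
  Under the volume constraint \<open>\<alpha>\<^sup>m \<beta>\<^sup>n\<^sup>-\<^sup>m = \<sigma>\<^sup>n\<close> the logarithmic terms agree, so the
  comparison is the weighted AM-GM inequality \<open>m/\<alpha> + (n-m)/\<beta> > n/\<sigma>\<close> for \<open>\<alpha> \<noteq> \<beta>\<close>,
  and the divergence blows up through the term \<open>(n-m)/\<beta>\<close>.

  The Gaussian integrals are computed by the substitution \<open>x = U diag(\<surd>d) y\<close> from a
  spectral decomposition \<open>U diag(d) U\<^sup>T\<close>, which turns the density into the standard normal one.\<close>

section \<open>Lebesgue measure under orthogonal maps\<close>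

text \<open>The change-of-variables theorems of HOL-Analysis require the index type to be of class
  \<^class>\<open>wellorder\<close>. A finite linear order is a well-order, so we transport them through a copy
  of the index type carrying that instance.\<close>

typedef 'a wellord = "UNIV :: 'a set" by simp

instance wellord :: (finite) finite
  by standard (metis type_definition.Abs_image[OF type_definition_wellord] finite_imageI finite)

instantiation wellord :: (linorder) linorder
begin

definition less_eq_wellord :: "'a wellord \<Rightarrow> 'a wellord \<Rightarrow> bool"
  where "x \<le> y \<longleftrightarrow> Rep_wellord x \<le> Rep_wellord y"

definition less_wellord :: "'a wellord \<Rightarrow> 'a wellord \<Rightarrow> bool"
  where "x < y \<longleftrightarrow> Rep_wellord x < Rep_wellord y"

instance
  by standard (auto simp: less_eq_wellord_def less_wellord_def Rep_wellord_inject[symmetric])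

end

instance wellord :: ("{finite,linorder}") wellorder
proof
  fix P :: "'a wellord \<Rightarrow> bool" and x :: "'a wellord"
  assume step: "\<And>x. (\<And>y. y < x \<Longrightarrow> P y) \<Longrightarrow> P x"
  show "P x"
  proof (rule ccontr)
    assume "\<not> P x"
    define z where "z = Min {y. \<not> P y}"
    have "\<not> P z"
      using \<open>\<not> P x\<close> unfolding z_def by (metis (mono_tags) Min_in finite empty_iff mem_Collect_eq)
    moreover have "P z"
      by (rule step) (metis Min_le finite leD mem_Collect_eq z_def)
    ultimately show False by contradiction
  qed
qed

lemma sum_Rep_wellord: "(\<Sum>j\<in>UNIV. f (Rep_wellord j)) = (\<Sum>i\<in>UNIV. f i)"
  by (rule sum.reindex_bij_witness[of _ Abs_wellord Rep_wellord])
    (simp_all add: Rep_wellord_inverse Abs_wellord_inverse)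

lemma prod_Rep_wellord: "(\<Prod>j\<in>UNIV. f (Rep_wellord j)) = (\<Prod>i\<in>UNIV. f i)"
  by (rule prod.reindex_bij_witness[of _ Abs_wellord Rep_wellord])
    (simp_all add: Rep_wellord_inverse Abs_wellord_inverse)

lemma Basis_vec_eq_range_axis: "(Basis :: (real^'n::finite) set) = range (\<lambda>i. axis i 1)"
  by (auto simp: Basis_vec_def)

lemma inj_axis_one: "inj (\<lambda>i::'n::finite. axis i (1::real))"
  by (auto simp: inj_def axis_eq_axis)

lemma sum_Basis_vec: "(\<Sum>b\<in>(Basis :: (real^'n::finite) set). f b) = (\<Sum>i\<in>UNIV. f (axis i 1))"
  by (simp add: Basis_vec_eq_range_axis sum.reindex inj_axis_one)

lemma prod_Basis_vec: "(\<Prod>b\<in>(Basis :: (real^'n::finite) set). f b) = (\<Prod>i\<in>UNIV. f (axis i 1))"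
  by (simp add: Basis_vec_eq_range_axis prod.reindex inj_axis_one)

lemma sum_Basis_scaleR_nth: "(\<Sum>b\<in>(Basis :: (real^'n) set). f b *\<^sub>R b) $ i = f (axis i 1)"
proof -
  have "(\<Sum>b\<in>(Basis :: (real^'n) set). f b *\<^sub>R b) $ i = (\<Sum>j\<in>UNIV. f (axis j 1) * axis j 1 $ i)"
    by (simp add: sum_component sum_Basis_vec)
  also have "\<dots> = (\<Sum>j\<in>UNIV. if j = i then f (axis j 1) else 0)"
    by (rule sum.cong) (auto simp: axis_def)
  finally show ?thesis by simp
qed

lemma borel_measurable_matrix_vector_mult [measurable]:
  "(*v) (A :: real^'n^'m) \<in> borel_measurable borel"
  by (intro borel_measurable_continuous_onI linear_continuous_on) (simp add: linear_linear)

lemma distr_lborel_orthogonal_matrix_wellorder: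
  fixes V :: "real^('m::{finite,wellorder})^('m::{finite,wellorder})"
  assumes V: "orthogonal_matrix V"
  shows "distr lborel borel ((*v) V) = lborel"
proof (rule lborel_eqI[symmetric])
  fix l u :: "real^('m::{finite,wellorder})"
  assume le: "\<And>b. b \<in> Basis \<Longrightarrow> l \<bullet> b \<le> u \<bullet> b"
  have VV: "transpose V ** V = mat 1" "V ** transpose V = mat 1"
    using V by (auto simp: orthogonal_matrix_def)
  have oT: "orthogonal_transformation ((*v) (transpose V))"
    using V by (simp add: orthogonal_transformation_matrix)
  have pre: "(*v) V -` box l u = (*v) (transpose V) ` box l u"
  proof (rule set_eqI, rule iffI)
    fix x assume "x \<in> (*v) V -` box l u"
    then show "x \<in> (*v) (transpose V) ` box l u"
      by (intro image_eqI[where x="V *v x"])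
        (simp_all del: transpose_matrix_vector add: matrix_vector_mul_assoc VV)
  next
    fix x assume "x \<in> (*v) (transpose V) ` box l u"
    then show "x \<in> (*v) V -` box l u"
      by (auto simp del: transpose_matrix_vector simp: matrix_vector_mul_assoc VV)
  qed
  have "(*v) V -` box l u \<in> sets borel"
    using measurable_sets[OF borel_measurable_matrix_vector_mult, of "box l u"] by simp
  then have "emeasure (distr lborel borel ((*v) V)) (box l u) = emeasure lebesgue ((*v) V -` box l u)"
    by (simp add: emeasure_distr)
  also have "\<dots> = measure lebesgue ((*v) V -` box l u)"
  proof -
    have "(*v) V -` box l u \<in> lmeasurable"
      unfolding pre by (rule measurable_orthogonal_image[OF oT]) simp
    then show ?thesis by (simp add: emeasure_eq_measure2)
  qed
  also have "\<dots> = measure lborel (box l u)"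
    unfolding pre using measure_orthogonal_image[OF oT, of "box l u"] by simp
  also have "\<dots> = (\<Prod>b\<in>Basis. (u - l) \<bullet> b)"
    using le by (simp add: measure_lborel_box_eq)
  finally show "emeasure (distr lborel borel ((*v) V)) (box l u) = (\<Prod>b\<in>Basis. (u - l) \<bullet> b)"
    using le by (simp add: prod_nonneg inner_diff_left)
qed simp

definition vec_of_wellord :: "real^'n wellord \<Rightarrow> real^'n"
  where "vec_of_wellord v = (\<chi> i. v $ Abs_wellord i)"

lemma borel_measurable_vec_of_wellord [measurable]: "vec_of_wellord \<in> borel_measurable borel"
proof -
  have "linear vec_of_wellord"
    unfolding linear_iff vec_of_wellord_def by (simp add: vec_eq_iff)
  then show ?thesis
    by (intro borel_measurable_continuous_onI linear_continuous_on) (simp add: linear_linear)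
qed

lemma distr_lborel_vec_of_wellord:
  "distr lborel borel vec_of_wellord = (lborel :: (real^'n::finite) measure)"
proof (rule lborel_eqI[symmetric])
  fix l u :: "real^'n"
  assume "\<And>b. b \<in> Basis \<Longrightarrow> l \<bullet> b \<le> u \<bullet> b"
  then have le: "l $ i \<le> u $ i" for i
    by (metis inner_axis real_inner_1_right axis_in_Basis_iff Basis_real_def insertI1)
  define w :: "real^'n \<Rightarrow> real^'n wellord" where "w x = (\<chi> j. x $ Rep_wellord j)" for x
  have pre: "vec_of_wellord -` box l u = box (w l) (w u)"
  proof -
    have "(\<forall>i. l $ i < v $ Abs_wellord i \<and> v $ Abs_wellord i < u $ i) \<longleftrightarrow>
          (\<forall>j. l $ Rep_wellord j < v $ j \<and> v $ j < u $ Rep_wellord j)" for v :: "real^'n wellord"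
      by (metis Abs_wellord_inverse Rep_wellord_inverse UNIV_I)
    then show ?thesis by (auto simp: mem_box_cart vec_of_wellord_def w_def)
  qed
  have "\<forall>b\<in>Basis. w l \<bullet> b \<le> w u \<bullet> b"
    using le by (auto simp: Basis_vec_def inner_axis w_def)
  then have "emeasure (distr lborel borel vec_of_wellord) (box l u)
      = ennreal (\<Prod>b\<in>Basis. (w u - w l) \<bullet> b)"
    by (simp add: emeasure_distr pre emeasure_lborel_box_eq)
  also have "\<dots> = ennreal (\<Prod>j\<in>UNIV. u $ Rep_wellord j - l $ Rep_wellord j)"
    by (simp add: prod_Basis_vec inner_axis w_def)
  finally show "emeasure (distr lborel borel vec_of_wellord) (box l u) = (\<Prod>b\<in>Basis. (u - l) \<bullet> b)"
    by (simp add: prod_Rep_wellord[where f="\<lambda>i. u $ i - l $ i"] prod_Basis_vec inner_axis)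
qed simp

lemma distr_lborel_orthogonal_matrix:
  fixes U :: "real^('n::{finite,linorder})^('n::{finite,linorder})"
  assumes U: "orthogonal_matrix U"
  shows "distr lborel borel ((*v) U) = lborel"
proof -
  define V :: "real^'n wellord^'n wellord" where "V = (\<chi> a b. U $ Rep_wellord a $ Rep_wellord b)"
  have UU: "transpose U ** U = mat 1" using U by (simp add: orthogonal_matrix)
  have "(\<Sum>k\<in>UNIV. U $ Rep_wellord k $ Rep_wellord a * U $ Rep_wellord k $ Rep_wellord b)
      = (if a = b then 1 else 0)" for a b
  proof -
    have "(\<Sum>k\<in>UNIV. U $ Rep_wellord k $ Rep_wellord a * U $ Rep_wellord k $ Rep_wellord b)
        = (transpose U ** U) $ Rep_wellord a $ Rep_wellord b"
      by (simp only: sum_Rep_wellord[where f="\<lambda>k. U $ k $ Rep_wellord a * U $ k $ Rep_wellord b"])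
        (simp add: matrix_matrix_mult_def transpose_def)
    then show ?thesis by (simp add: UU mat_def Rep_wellord_inject)
  qed
  then have "transpose V ** V = mat 1"
    by (simp add: vec_eq_iff matrix_matrix_mult_def transpose_def V_def mat_def)
  then have V: "orthogonal_matrix V" by (simp add: orthogonal_matrix)
  have "(\<Sum>k\<in>UNIV. U $ i $ k * v $ Abs_wellord k) = (\<Sum>j\<in>UNIV. U $ i $ Rep_wellord j * v $ j)"
    for i and v :: "real^'n wellord"
    using sum_Rep_wellord[where f="\<lambda>k. U $ i $ k * v $ Abs_wellord k"] by (simp add: Rep_wellord_inverse)
  then have comm: "(*v) U \<circ> vec_of_wellord = vec_of_wellord \<circ> (*v) V"
    by (simp add: fun_eq_iff vec_eq_iff vec_of_wellord_def matrix_vector_mult_def V_def Abs_wellord_inverse)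
  have "distr lborel borel ((*v) U) = distr (distr lborel borel vec_of_wellord) borel ((*v) U)"
    by (simp add: distr_lborel_vec_of_wellord)
  also have "\<dots> = distr (distr lborel borel ((*v) V)) borel vec_of_wellord"
    by (simp add: distr_distr comm)
  also have "\<dots> = lborel"
    by (simp add: distr_lborel_orthogonal_matrix_wellorder[OF V] distr_lborel_vec_of_wellord)
  finally show ?thesis .
qed

section \<open>Symmetric positive-definite matrices\<close>

lemma diag_mat_mult: "diag_mat a ** diag_mat b = diag_mat (\<chi> i. a $ i * b $ i)"
proof -
  have "(\<Sum>k\<in>UNIV. (if i = k then a $ i else 0) * (if k = j then b $ k else 0))
      = (\<Sum>k\<in>UNIV. if k = i then (if i = j then a $ i * b $ i else 0) else 0)" for i j
    by (rule sum.cong) auto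
  then show ?thesis by (simp add: vec_eq_iff matrix_matrix_mult_def diag_mat_def)
qed

lemma diag_mat_mult_vector: "diag_mat a *v y = (\<chi> i. a $ i * y $ i)"
proof -
  have "(\<Sum>j\<in>UNIV. (if i = j then a $ i else 0) * y $ j) = (\<Sum>j\<in>UNIV. if j = i then a $ i * y $ j else 0)"
    for i by (rule sum.cong) auto
  then show ?thesis by (simp add: vec_eq_iff matrix_vector_mult_def diag_mat_def)
qed

lemma transpose_diag_mat [simp]: "transpose (diag_mat a) = diag_mat a"
  by (simp add: vec_eq_iff transpose_def diag_mat_def)

lemma det_diag_mat: "det (diag_mat d) = (\<Prod>i\<in>UNIV. d $ i)"
  by (subst det_diagonal) (simp_all add: diag_mat_def)

lemma diag_mat_const: "diag_mat (\<chi> i. c) = c *\<^sub>R mat 1"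
  by (simp add: vec_eq_iff diag_mat_def mat_def)

lemma orthogonal_matrix_inner:
  "orthogonal_matrix U \<Longrightarrow> (U *v a) \<bullet> (U *v b) = a \<bullet> (b :: real^'n)"
  using orthogonal_transformation_matrix[of "(*v) U"]
  unfolding orthogonal_transformation_def by (simp add: linear_linear)

lemma inner_matrix_vector_mult_transpose: "x \<bullet> (A *v y) = (transpose A *v x) \<bullet> (y :: real^'n)"
  by (simp add: dot_lmul_matrix)

lemma symmetric_matrix_inner: "transpose A = A \<Longrightarrow> x \<bullet> (A *v y) = (A *v x) \<bullet> (y :: real^'n)"
  by (metis inner_matrix_vector_mult_transpose)

lemma linear_le_quadratic_imp_zero:
  fixes c K :: real
  assumes "\<And>t. 2 * t * c \<le> t\<^sup>2 * K"
  shows "c = 0"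
proof (rule ccontr)
  assume "c \<noteq> 0"
  then have c2: "c\<^sup>2 > 0" by simp
  define s where "s = \<bar>K\<bar> + 1"
  have s: "s > 0" by (simp add: s_def)
  have "2 * (c / s) * c \<le> (c / s)\<^sup>2 * K" by (rule assms)
  then have "2 * c\<^sup>2 / s \<le> c\<^sup>2 * K / s\<^sup>2"
    by (simp add: power_divide power2_eq_square)
  then have "2 * s * c\<^sup>2 \<le> c\<^sup>2 * K"
    using s by (simp add: divide_le_eq le_divide_eq power2_eq_square mult_ac)
  then have "2 * s \<le> K" using c2 by (simp add: mult.commute)
  then show False by (simp add: s_def)
qed

text \<open>First-order condition at a maximiser \<open>v\<close>: with \<open>f x = x \<bullet> (A *v x)\<close>, the bound
  \<open>f ((v + t w) / |v + t w|) \<le> f v\<close> reads \<open>2 t (w \<bullet> A v) \<le> t\<^sup>2 (f v |w|\<^sup>2 - f w)\<close> for all \<open>t\<close>.\<close>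
lemma symmetric_quadratic_form_maximiser_orthogonal:
  fixes A :: "real^'n^'n"
  assumes sym: "transpose A = A" and V: "subspace V" and v: "v \<in> V" "norm v = 1"
    and max: "\<And>y. y \<in> V \<Longrightarrow> norm y = 1 \<Longrightarrow> y \<bullet> (A *v y) \<le> v \<bullet> (A *v v)"
    and w: "w \<in> V" "w \<bullet> v = 0"
  shows "w \<bullet> (A *v v) = 0"
proof (rule linear_le_quadratic_imp_zero)
  fix t :: real
  define f where "f x = x \<bullet> (A *v x)" for x
  define u where "u = v + t *\<^sub>R w"
  have vv: "v \<bullet> v = 1" using v(2) by (simp add: norm_eq_1)
  have uu: "u \<bullet> u = 1 + t\<^sup>2 * (w \<bullet> w)"
    using w vv by (simp add: u_def inner_add_left inner_add_right inner_commute power2_eq_square)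
  have upos: "u \<bullet> u > 0" unfolding uu by (simp add: add_pos_nonneg)
  have "u /\<^sub>R norm u \<in> V"
    using V v w by (simp add: u_def subspace_add subspace_scale)
  moreover have "norm (u /\<^sub>R norm u) = 1" using upos by simp
  ultimately have "f (u /\<^sub>R norm u) \<le> f v"
    unfolding f_def by (rule max)
  moreover have "f (u /\<^sub>R norm u) = f u / (u \<bullet> u)"
    by (simp add: f_def matrix_vector_mult_scaleR power2_norm_eq_inner[symmetric] power2_eq_square
        inner_scaleR_left inner_scaleR_right) (simp add: field_simps)
  ultimately have "f u \<le> f v * (u \<bullet> u)" using upos by (simp add: divide_le_eq)
  moreover have "f u = f v + 2 * t * (w \<bullet> (A *v v)) + t\<^sup>2 * f w"
  proof -
    have "v \<bullet> (A *v w) = w \<bullet> (A *v v)"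
      using symmetric_matrix_inner[OF sym, of v w] by (simp add: inner_commute)
    then show ?thesis
      by (simp add: u_def f_def matrix_vector_right_distrib matrix_vector_mult_scaleR
          inner_add_left inner_add_right power2_eq_square algebra_simps)
  qed
  ultimately show "2 * t * (w \<bullet> (A *v v)) \<le> t\<^sup>2 * (f v * (w \<bullet> w) - f w)"
    unfolding uu by (simp add: algebra_simps)
qed

lemma symmetric_matrix_eigenvector_in_invariant_subspace:
  fixes A :: "real^'n^'n"
  assumes sym: "transpose A = A" and V: "subspace V" "V \<noteq> {0}" and inv: "\<forall>x\<in>V. A *v x \<in> V"
  obtains v where "v \<in> V" "norm v = 1" "A *v v = (v \<bullet> (A *v v)) *\<^sub>R v"
proof -
  define K where "K = V \<inter> sphere 0 1"
  have "compact K" unfolding K_def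
    by (intro closed_Int_compact closed_subspace V compact_sphere)
  moreover have "K \<noteq> {}"
  proof -
    obtain x where x: "x \<in> V" "x \<noteq> 0" using V subspace_0 by blast
    then have "x /\<^sub>R norm x \<in> K" using V(1) by (simp add: K_def subspace_scale)
    then show ?thesis by blast
  qed
  moreover have "continuous_on K (\<lambda>x. x \<bullet> (A *v x))"
    by (intro continuous_intros linear_continuous_on) (simp add: linear_linear)
  ultimately obtain v where "v \<in> K" and vmax: "\<forall>y\<in>K. y \<bullet> (A *v y) \<le> v \<bullet> (A *v v)"
    using continuous_attains_sup[of K "\<lambda>x. x \<bullet> (A *v x)"] by blast
  then have v: "v \<in> V" "norm v = 1" by (auto simp: K_def)
  have max: "\<And>y. y \<in> V \<Longrightarrow> norm y = 1 \<Longrightarrow> y \<bullet> (A *v y) \<le> v \<bullet> (A *v v)"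
    using vmax by (simp add: K_def)
  define l where "l = v \<bullet> (A *v v)"
  define w where "w = A *v v - l *\<^sub>R v"
  have wV: "w \<in> V" using V(1) inv v by (simp add: w_def subspace_diff subspace_scale)
  have "w \<bullet> v = v \<bullet> (A *v v) - l * (v \<bullet> v)"
    by (simp add: w_def inner_diff_left inner_diff_right inner_commute)
  then have wv: "w \<bullet> v = 0"
    using v(2) by (simp add: l_def norm_eq_1)
  have "w \<bullet> w = w \<bullet> (A *v v) - l * (w \<bullet> v)"
    by (simp add: w_def inner_diff_right)
  also have "\<dots> = 0"
    using symmetric_quadratic_form_maximiser_orthogonal[OF sym V(1) v max wV wv] wv by simp
  finally have "w = 0" by simp
  then have "A *v v = l *\<^sub>R v" by (simp add: w_def)
  then show ?thesis using that v by (simp add: l_def)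
qed

lemma symmetric_matrix_orthonormal_eigenvectors:
  fixes A :: "real^'n^'n"
  assumes sym: "transpose A = A"
  shows "subspace V \<Longrightarrow> (\<forall>x\<in>V. A *v x \<in> V) \<Longrightarrow> dim V = k \<Longrightarrow>
    \<exists>B. finite B \<and> card B = k \<and> B \<subseteq> V \<and> (\<forall>x\<in>B. \<forall>y\<in>B. x \<noteq> y \<longrightarrow> x \<bullet> y = 0) \<and>
        (\<forall>b\<in>B. norm b = 1 \<and> A *v b = (b \<bullet> (A *v b)) *\<^sub>R b)"
proof (induction k arbitrary: V)
  case 0
  then show ?case by (intro exI[of _ "{}"]) auto
next
  case (Suc k)
  have "V \<noteq> {0}" using Suc.prems(3) by auto
  then obtain v where v: "v \<in> V" "norm v = 1" "A *v v = (v \<bullet> (A *v v)) *\<^sub>R v"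
    using symmetric_matrix_eigenvector_in_invariant_subspace[OF sym Suc.prems(1) _ Suc.prems(2)]
    by blast
  define W where "W = {y \<in> V. \<forall>x \<in> span {v}. orthogonal x y}"
  have W_eq: "W = {y\<in>V. y \<bullet> v = 0}"
    by (auto simp: W_def orthogonal_def inner_commute span_singleton)
  have subW: "subspace W"
  proof -
    have "W = V \<inter> {y. \<forall>x \<in> span {v}. orthogonal x y}" by (auto simp: W_def)
    then show ?thesis using Suc.prems(1) subspace_orthogonal_to_vectors subspace_inter by auto
  qed
  have "dim W + dim (span {v}) = dim V"
    unfolding W_def using v(1) Suc.prems(1)
    by (intro dim_subspace_orthogonal_to_vectors subspace_span) (simp_all add: span_minimal)
  moreover have "dim (span {v}) = 1" using v(2) by auto
  ultimately have dimW: "dim W = k" using Suc.prems(3) by simp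
  have invW: "\<forall>x\<in>W. A *v x \<in> W"
  proof
    fix x assume "x \<in> W"
    then have x: "x \<in> V" "x \<bullet> v = 0" by (auto simp: W_eq)
    have "(A *v x) \<bullet> v = x \<bullet> (A *v v)" using symmetric_matrix_inner[OF sym, of x v] by simp
    also have "\<dots> = 0" by (subst v(3)) (simp add: x(2))
    finally show "A *v x \<in> W" using x Suc.prems(2) by (auto simp: W_eq)
  qed
  obtain B where B: "finite B" "card B = k" "B \<subseteq> W" "\<forall>x\<in>B. \<forall>y\<in>B. x \<noteq> y \<longrightarrow> x \<bullet> y = 0"
      "\<forall>b\<in>B. norm b = 1 \<and> A *v b = (b \<bullet> (A *v b)) *\<^sub>R b"
    using Suc.IH[OF subW invW dimW] by blast
  have Bv: "b \<bullet> v = 0" if "b \<in> B" for b using B(3) that by (auto simp: W_eq)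
  have "v \<notin> B" using Bv v(2) by (force simp: norm_eq_1)
  then show ?case
    using B Bv v by (intro exI[of _ "insert v B"]) (auto simp: W_eq inner_commute)
qed

lemma symmetric_matrix_spectral:
  fixes A :: "real^'n^'n"
  assumes sym: "transpose A = A"
  obtains U d where "orthogonal_matrix U" "A = U ** diag_mat d ** transpose U"
proof -
  obtain B where B: "finite B" "card B = CARD('n)" "\<forall>x\<in>B. \<forall>y\<in>B. x \<noteq> y \<longrightarrow> x \<bullet> y = 0"
      "\<forall>b\<in>B. norm b = 1 \<and> A *v b = (b \<bullet> (A *v b)) *\<^sub>R b"
    using symmetric_matrix_orthonormal_eigenvectors[OF sym subspace_UNIV, of "CARD('n)"] by auto
  obtain e where e: "bij_betw e (UNIV :: 'n set) B"
    using finite_same_card_bij[of "UNIV :: 'n set" B] B by auto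
  have eB: "e j \<in> B" for j using e by (auto simp: bij_betw_def)
  have einj: "e j = e k \<Longrightarrow> j = k" for j k using e by (auto simp: bij_betw_def inj_def)
  define U :: "real^'n^'n" where "U = (\<chi> i j. e j $ i)"
  define d :: "real^'n" where "d = (\<chi> j. e j \<bullet> (A *v e j))"
  have ee: "e j \<bullet> e k = (if j = k then 1 else 0)" for j k
    using B(3,4) eB einj by (auto simp: norm_eq_1) (metis einj)
  have "(transpose U ** U) $ j $ k = e j \<bullet> e k" for j k
    by (simp add: matrix_matrix_mult_def transpose_def U_def inner_vec_def)
  then have "transpose U ** U = mat 1"
    by (simp add: vec_eq_iff ee mat_def)
  then have oU: "orthogonal_matrix U" by (simp add: orthogonal_matrix)
  have eig: "A *v e j = d $ j *\<^sub>R e j" for j using B(4) eB by (simp add: d_def)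
  have "A ** U = U ** diag_mat d"
  proof -
    have "(A ** U) $ i $ k = (A *v e k) $ i" for i k
      by (simp add: matrix_matrix_mult_def matrix_vector_mult_def U_def)
    moreover have "(U ** diag_mat d) $ i $ k = d $ k * e k $ i" for i k
    proof -
      have "(\<Sum>j\<in>UNIV. U $ i $ j * (if j = k then d $ j else 0))
          = (\<Sum>j\<in>UNIV. if j = k then U $ i $ k * d $ k else 0)"
        by (rule sum.cong) auto
      then show ?thesis by (simp add: matrix_matrix_mult_def diag_mat_def U_def)
    qed
    ultimately show ?thesis by (simp add: vec_eq_iff eig)
  qed
  then have "A = U ** diag_mat d ** transpose U"
    using oU by (metis matrix_mul_assoc matrix_mul_rid orthogonal_matrix_def)
  with oU that show ?thesis by blast
qed

lemma orthogonal_matrix_diag_quadratic: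
  assumes "orthogonal_matrix U"
  shows "(U *v x) \<bullet> ((U ** diag_mat d ** transpose U) *v (U *v x)) = x \<bullet> (diag_mat d *v x)"
proof -
  have "transpose U ** U = mat 1" using assms by (simp add: orthogonal_matrix)
  then have "(U ** diag_mat d ** transpose U) ** U = U ** diag_mat d"
    by (metis matrix_mul_assoc matrix_mul_rid)
  then have "(U ** diag_mat d ** transpose U) *v (U *v x) = U *v (diag_mat d *v x)"
    by (simp add: matrix_vector_mul_assoc)
  then show ?thesis using orthogonal_matrix_inner[OF assms] by simp
qed

lemma sym_posdef_spectral:
  fixes A :: "real^'n^'n"
  assumes A: "sym_posdef A"
  obtains U d where "orthogonal_matrix U" "A = U ** diag_mat d ** transpose U" "\<And>j. d $ j > 0"
proof -
  obtain U d where U: "orthogonal_matrix U" "A = U ** diag_mat d ** transpose U"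
    using symmetric_matrix_spectral A unfolding sym_posdef_def by metis
  have "d $ j > 0" for j
  proof -
    have "U *v axis j 1 \<noteq> 0"
      using orthogonal_matrix_inner[OF U(1), of "axis j 1" "axis j 1"] by (auto simp: inner_axis)
    then have "0 < (U *v axis j 1) \<bullet> (A *v (U *v axis j 1))"
      using A by (simp add: sym_posdef_def)
    also have "\<dots> = axis j 1 \<bullet> (diag_mat d *v axis j 1)"
      by (simp add: U(2) orthogonal_matrix_diag_quadratic[OF U(1)])
    also have "diag_mat d *v axis j 1 = axis j (d $ j)"
      by (simp add: diag_mat_mult_vector vec_eq_iff axis_def)
    also have "axis j 1 \<bullet> axis j (d $ j) = d $ j"
      by (simp add: inner_axis_axis)
    finally show ?thesis .
  qed
  with U that show ?thesis by blast
qed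

lemma sym_posdef_quadratic_nonneg: "sym_posdef A \<Longrightarrow> 0 \<le> x \<bullet> (A *v x)"
  by (cases "x = 0") (auto simp: sym_posdef_def less_imp_le)

lemma sym_posdef_quadratic_eq_0_iff: "sym_posdef A \<Longrightarrow> x \<bullet> (A *v x) = 0 \<longleftrightarrow> x = 0"
  by (auto simp: sym_posdef_def dest: spec[of _ x])

lemma sym_posdef_sqrt_exists:
  fixes A :: "real^'n^'n"
  assumes A: "sym_posdef A"
  shows "\<exists>S. sym_posdef S \<and> S ** S = A"
proof -
  obtain U d where U: "orthogonal_matrix U" "A = U ** diag_mat d ** transpose U"
    and d: "\<And>j. d $ j > 0"
    using sym_posdef_spectral[OF A] by blast
  have UtU: "transpose U ** U = mat 1" and UUt: "U ** transpose U = mat 1"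
    using U(1) by (auto simp: orthogonal_matrix_def)
  define s :: "real^'n" where "s = (\<chi> j. sqrt (d $ j))"
  define S where "S = U ** diag_mat s ** transpose U"
  have "transpose S = S"
    by (simp add: S_def matrix_transpose_mul matrix_mul_assoc)
  moreover have "S ** S = A"
  proof -
    have "S ** S = U ** (diag_mat s ** ((transpose U ** U) ** diag_mat s)) ** transpose U"
      by (simp add: S_def matrix_mul_assoc)
    also have "\<dots> = A"
      using d by (simp add: U(2) UtU diag_mat_mult s_def less_imp_le vec_lambda_eta)
    finally show ?thesis .
  qed
  moreover have "x \<bullet> (S *v x) > 0" if "x \<noteq> 0" for x
  proof -
    define y where "y = transpose U *v x"
    have x: "x = U *v y"
      by (simp add: y_def matrix_vector_mul_assoc UUt del: transpose_matrix_vector)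
    have "y \<noteq> 0" using that x by auto
    then obtain j where j: "y $ j \<noteq> 0" by (auto simp: vec_eq_iff)
    have "x \<bullet> (S *v x) = (\<Sum>i\<in>UNIV. s $ i * (y $ i)\<^sup>2)"
      unfolding x S_def orthogonal_matrix_diag_quadratic[OF U(1)]
      by (simp add: diag_mat_mult_vector inner_vec_def power2_eq_square mult_ac)
    also have "\<dots> > 0"
      using d j by (intro sum_pos2[of UNIV j]) (auto simp: s_def less_imp_le)
    finally show ?thesis .
  qed
  ultimately show ?thesis by (auto simp: sym_posdef_def)
qed

lemma matrix_diff_ldistrib: "(A :: real^'n^'m) ** (B - C) = A ** B - A ** C"
  by (simp add: vec_eq_iff matrix_matrix_mult_def sum_subtractf algebra_simps)

lemma matrix_diff_rdistrib: "((B :: real^'n^'m) - C) ** A = B ** A - C ** A"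
  by (simp add: vec_eq_iff matrix_matrix_mult_def sum_subtractf algebra_simps)

text \<open>For \<open>X = S - T\<close>, \<open>S ** S = T ** T\<close> gives \<open>S ** X + X ** T = 0\<close>; hence the traces of
  \<open>transpose X ** S ** X\<close> and \<open>X ** T ** transpose X\<close>, sums of nonnegative quadratic forms
  in the columns resp. rows of \<open>X\<close>, add up to \<open>0\<close>.\<close>
lemma sym_posdef_sqrt_unique:
  fixes S T :: "real^'n^'n"
  assumes S: "sym_posdef S" and T: "sym_posdef T" and eq: "S ** S = T ** T"
  shows "S = T"
proof -
  define X where "X = S - T"
  define col where "col k = (\<chi> i. X $ i $ k)" for k
  have "S ** X + X ** T = 0"
    using eq by (simp add: X_def matrix_diff_ldistrib matrix_diff_rdistrib)
  then have "trace (transpose X ** (S ** X)) + trace (transpose X ** (X ** T)) = 0"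
    by (metis matrix_add_ldistrib times0_right trace_add trace_0 mat_0)
  moreover have "trace (transpose X ** (X ** T)) = trace (X ** (T ** transpose X))"
    by (metis matrix_mul_assoc trace_mul_sym)
  moreover have "trace (transpose X ** (S ** X)) = (\<Sum>k\<in>UNIV. col k \<bullet> (S *v col k))"
    by (simp add: col_def trace_def matrix_matrix_mult_def transpose_def inner_vec_def
        matrix_vector_mult_def)
  moreover have "trace (X ** (T ** transpose X)) = (\<Sum>k\<in>UNIV. X $ k \<bullet> (T *v X $ k))"
    by (simp add: trace_def matrix_matrix_mult_def transpose_def inner_vec_def matrix_vector_mult_def)
  moreover have "0 \<le> col k \<bullet> (S *v col k)" "0 \<le> X $ k \<bullet> (T *v X $ k)" for k
    using S T by (simp_all add: sym_posdef_quadratic_nonneg)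
  ultimately have "(\<Sum>k\<in>UNIV. col k \<bullet> (S *v col k)) = 0"
    by (smt (verit) sum_nonneg)
  then have "col k = 0" for k
    using S by (simp add: sum_nonneg_eq_0_iff sym_posdef_quadratic_nonneg sym_posdef_quadratic_eq_0_iff)
  then show ?thesis by (simp add: X_def col_def vec_eq_iff)
qed

lemma
  assumes "sym_posdef A"
  shows sym_posdef_mat_sqrt: "sym_posdef (mat_sqrt A)"
    and mat_sqrt_mult_self: "mat_sqrt A ** mat_sqrt A = A"
proof -
  have "\<exists>!S. sym_posdef S \<and> S ** S = A"
    using sym_posdef_sqrt_exists[OF assms] sym_posdef_sqrt_unique by metis
  then have "sym_posdef (mat_sqrt A) \<and> mat_sqrt A ** mat_sqrt A = A"
    unfolding mat_sqrt_def by (rule theI')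
  then show "sym_posdef (mat_sqrt A)" "mat_sqrt A ** mat_sqrt A = A" by auto
qed

lemma matrix_inv_unique:
  fixes A X :: "real^'n^'n"
  assumes "A ** X = mat 1" "X ** A = mat 1"
  shows "matrix_inv A = X"
proof -
  define Y where "Y = matrix_inv A"
  have "A ** Y = mat 1 \<and> Y ** A = mat 1"
    unfolding Y_def matrix_inv_def by (rule someI[of _ X]) (use assms in simp)
  then have "Y = Y ** (A ** X)" "Y ** A = mat 1" by (simp_all add: assms)
  then show ?thesis by (simp add: Y_def matrix_mul_assoc)
qed

lemma
  fixes A :: "real^'n^'n"
  assumes "det A \<noteq> 0"
  shows matrix_inv_right: "A ** matrix_inv A = mat 1"
    and matrix_inv_left: "matrix_inv A ** A = mat 1"
proof -
  obtain X where "A ** X = mat 1" "X ** A = mat 1"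
    using assms invertible_det_nz unfolding invertible_def by blast
  moreover from this have "matrix_inv A = X" by (rule matrix_inv_unique)
  ultimately show "A ** matrix_inv A = mat 1" "matrix_inv A ** A = mat 1" by simp_all
qed

lemma matrix_inv_mult:
  fixes A B :: "real^'n^'n"
  assumes "det A \<noteq> 0" "det B \<noteq> 0"
  shows "matrix_inv (A ** B) = matrix_inv B ** matrix_inv A"
proof (rule matrix_inv_unique)
  show "A ** B ** (matrix_inv B ** matrix_inv A) = mat 1"
    by (metis assms matrix_inv_right matrix_mul_assoc matrix_mul_rid)
  show "matrix_inv B ** matrix_inv A ** (A ** B) = mat 1"
    by (metis assms matrix_inv_left matrix_mul_assoc matrix_mul_rid)
qed

lemma matrix_inv_diag_mat:
  assumes "\<And>i. d $ i \<noteq> 0"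
  shows "matrix_inv (diag_mat d) = diag_mat (\<chi> i. 1 / d $ i)"
proof -
  have "(\<chi> i. d $ i * (1 / d $ i)) = (\<chi> i. 1)" "(\<chi> i. 1 / d $ i * d $ i) = (\<chi> i. 1)"
    using assms by (simp_all add: vec_eq_iff)
  then show ?thesis
    by (intro matrix_inv_unique) (simp_all add: diag_mat_mult diag_mat_const)
qed

lemma det_orthogonal_matrix_nz:
  fixes U :: "real^'n^'n"
  assumes "orthogonal_matrix U"
  shows "det U \<noteq> 0"
  using det_orthogonal_matrix[OF assms] by auto

lemma det_spectral:
  fixes U :: "real^'n^'n"
  assumes "orthogonal_matrix U"
  shows "det (U ** diag_mat d ** transpose U) = (\<Prod>i\<in>UNIV. d $ i)"
proof -
  have "det U * det U = 1" using det_orthogonal_matrix[OF assms] by auto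
  then show ?thesis by (simp add: det_mul det_diag_mat)
qed

lemma matrix_inv_spectral:
  fixes U :: "real^'n^'n"
  assumes U: "orthogonal_matrix U" and d: "\<And>i. d $ i \<noteq> 0"
  shows "matrix_inv (U ** diag_mat d ** transpose U) = U ** diag_mat (\<chi> i. 1 / d $ i) ** transpose U"
proof -
  have "matrix_inv (transpose U) = U" "matrix_inv U = transpose U"
    using U by (simp_all add: matrix_inv_unique orthogonal_matrix_def)
  moreover have "det (diag_mat d) \<noteq> 0" using d by (simp add: det_diag_mat)
  ultimately show ?thesis
    using det_orthogonal_matrix_nz[OF U]
    by (simp add: matrix_inv_mult det_mul matrix_inv_diag_mat[OF d] matrix_mul_assoc)
qed

lemma sym_posdef_det_pos: "sym_posdef A \<Longrightarrow> det A > 0"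
  by (metis sym_posdef_spectral det_spectral prod_pos UNIV_I)

section \<open>Gaussian integrals\<close>

definition std_normal_vec_density :: "real^'n \<Rightarrow> real"
  where "std_normal_vec_density y = (\<Prod>i\<in>UNIV. std_normal_density (y $ i))"

lemma std_normal_vec_density_eq:
  "std_normal_vec_density (y :: real^'n) = exp (- (y \<bullet> y) / 2) / sqrt (2 * pi) ^ CARD('n)"
proof -
  have "std_normal_vec_density y = (\<Prod>i\<in>UNIV. (1 / sqrt (2 * pi)) * exp (- (y $ i)\<^sup>2 / 2))"
    by (simp add: std_normal_vec_density_def std_normal_density_def)
  also have "\<dots> = (1 / sqrt (2 * pi)) ^ CARD('n) * exp (\<Sum>i\<in>UNIV. - (y $ i)\<^sup>2 / 2)"
    by (simp only: prod.distrib prod_constant exp_sum[OF finite, symmetric])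
  also have "(\<Sum>i\<in>UNIV. - (y $ i)\<^sup>2 / 2) = - (y \<bullet> y) / 2"
    by (simp add: inner_vec_def power2_eq_square sum_divide_distrib sum_negf)
  finally show ?thesis by (simp add: power_one_over)
qed

lemma has_bochner_integral_lborel_vec_prod:
  fixes h :: "'n::finite \<Rightarrow> real \<Rightarrow> real"
  assumes int: "\<And>i. integrable lborel (h i)"
  shows "has_bochner_integral lborel (\<lambda>y::real^'n. \<Prod>i\<in>UNIV. h i (y $ i))
    (\<Prod>i\<in>UNIV. \<integral>x. h i x \<partial>lborel)"
proof -
  interpret P: product_sigma_finite "\<lambda>_::real^'n. lborel :: real measure"
    by standard
  define F where "F = (\<lambda>f. \<Sum>b\<in>(Basis::(real^'n) set). f b *\<^sub>R b)"
  define H where "H = (\<lambda>b::real^'n. h (axis_index b))"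
  have hm[measurable]: "h i \<in> borel_measurable borel" for i using int[of i] by auto
  have Fm[measurable]: "F \<in> measurable (\<Pi>\<^sub>M b\<in>Basis. lborel) borel"
    unfolding F_def by measurable
  have eq: "(\<Prod>i\<in>UNIV. h i (F f $ i)) = (\<Prod>b\<in>Basis. H b (f b))" for f
    by (simp only: F_def sum_Basis_scaleR_nth) (simp add: prod_Basis_vec H_def)
  have intH: "\<And>b. b \<in> Basis \<Longrightarrow> integrable lborel (H b)" by (simp add: H_def int)
  have "integrable (\<Pi>\<^sub>M b\<in>Basis. lborel) (\<lambda>f. \<Prod>b\<in>Basis. H b (f b))"
    by (rule P.product_integrable_prod) (simp_all add: intH)
  moreover have "(\<integral>f. (\<Prod>b\<in>Basis. H b (f b)) \<partial>(\<Pi>\<^sub>M b\<in>Basis. lborel))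
      = (\<Prod>b\<in>Basis. integral\<^sup>L lborel (H b))"
    by (rule P.product_integral_prod) (simp_all add: intH)
  ultimately have "has_bochner_integral (\<Pi>\<^sub>M b\<in>Basis. lborel) (\<lambda>f. \<Prod>b\<in>Basis. H b (f b))
      (\<Prod>b\<in>Basis. integral\<^sup>L lborel (H b))"
    by (simp add: has_bochner_integral_iff)
  then have "has_bochner_integral (distr (\<Pi>\<^sub>M b\<in>Basis. lborel) borel F) (\<lambda>y. \<Prod>i\<in>UNIV. h i (y $ i))
      (\<Prod>b\<in>Basis. integral\<^sup>L lborel (H b))"
    by (intro has_bochner_integral_distr) (simp_all add: eq)
  then show ?thesis
    by (simp add: F_def flip: lborel_eq) (simp add: prod_Basis_vec H_def)
qed

lemma has_bochner_integral_std_normal_vec_pair: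
  fixes j k :: "'n::finite"
  shows "has_bochner_integral lborel (\<lambda>y::real^'n. std_normal_vec_density y * (y $ j * y $ k))
    (if j = k then 1 else 0)"
proof -
  define e where "e i = (if i = j then 1 else 0) + (if i = k then 1 else (0::nat))" for i
  have "(y $ i) ^ e i = (if i = j then y $ i else 1) * (if i = k then y $ i else 1)" for y :: "real^'n" and i
    by (simp add: e_def power_add)
  then have eq: "(\<Prod>i\<in>UNIV. std_normal_density (y $ i) * (y $ i) ^ e i)
      = std_normal_vec_density y * (y $ j * y $ k)" for y :: "real^'n"
    by (simp add: prod.distrib std_normal_vec_density_def prod.delta' mult_ac)
  have moment: "(\<integral>x. std_normal_density x * x ^ e i \<partial>lborel)
      = (if e i = 1 then 0 else 1)" for i
  proof -
    have "e i \<in> {0, 1, 2}" by (simp add: e_def)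
    then show ?thesis
      using integral_std_normal_moment_even[of 0] integral_std_normal_moment_odd[of 0]
        integral_std_normal_moment_even[of 1]
      by (auto simp: fact_numeral)
  qed
  have "(\<Prod>i\<in>UNIV. if e i = 1 then 0 else 1 :: real) = (if j = k then 1 else 0)"
    by (cases "j = k") (auto simp: e_def prod_zero_iff intro!: prod.neutral)
  then show ?thesis
    using has_bochner_integral_lborel_vec_prod[of "\<lambda>i x. std_normal_density x * x ^ e i"]
    by (simp add: integrable_std_normal_moment eq moment)
qed

lemma has_bochner_integral_std_normal_vec:
  "has_bochner_integral lborel (std_normal_vec_density :: real^'n \<Rightarrow> real) 1"
  using has_bochner_integral_lborel_vec_prod[of "\<lambda>_. std_normal_density"]
    integrable_std_normal_moment[of 0] integral_std_normal_moment_even[of 0]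
  by (simp add: std_normal_vec_density_def[abs_def])

lemma has_bochner_integral_std_normal_vec_quadratic:
  "has_bochner_integral lborel (\<lambda>y. std_normal_vec_density y * (y \<bullet> (N *v y))) (trace N)"
proof -
  have "y \<bullet> (N *v y) = (\<Sum>j\<in>UNIV. \<Sum>k\<in>UNIV. N $ j $ k * (y $ j * y $ k))" for y
    by (simp add: inner_vec_def matrix_vector_mult_def sum_distrib_left mult_ac)
  then have eq: "std_normal_vec_density y * (y \<bullet> (N *v y))
      = (\<Sum>j\<in>UNIV. \<Sum>k\<in>UNIV. N $ j $ k * (std_normal_vec_density y * (y $ j * y $ k)))" for y
    by (simp add: sum_distrib_left mult_ac)
  have "has_bochner_integral lborel
      (\<lambda>y. \<Sum>j\<in>UNIV. \<Sum>k\<in>UNIV. N $ j $ k * (std_normal_vec_density y * (y $ j * y $ k)))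
      (\<Sum>j\<in>UNIV. \<Sum>k\<in>UNIV. N $ j $ k * (if j = k then 1 else 0))"
    by (intro has_bochner_integral_sum has_bochner_integral_mult_right
        has_bochner_integral_std_normal_vec_pair)
  moreover have "(\<Sum>j\<in>UNIV. \<Sum>k\<in>UNIV. N $ j $ k * (if j = k then 1 else 0)) = trace N"
    by (simp add: trace_def if_distrib cong: if_cong)
  ultimately show ?thesis by (simp add: eq)
qed

lemma lborel_eq_density_distr_diag_mat:
  fixes s :: "real^'n"
  assumes s: "\<And>i. s $ i \<noteq> 0"
  shows "lborel = density (distr lborel borel ((*v) (diag_mat s))) (\<lambda>_. ennreal (\<Prod>i\<in>UNIV. \<bar>s $ i\<bar>))"
proof -
  define c where "c = (\<lambda>b::real^'n. s $ axis_index b)"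
  have c: "\<And>j. j \<in> Basis \<Longrightarrow> c j \<noteq> 0" using s by (auto simp: c_def Basis_vec_def)
  have T: "(\<lambda>x. 0 + (\<Sum>j\<in>Basis. (c j * (x \<bullet> j)) *\<^sub>R j)) = (*v) (diag_mat s)"
  proof
    fix x :: "real^'n"
    show "0 + (\<Sum>j\<in>Basis. (c j * (x \<bullet> j)) *\<^sub>R j) = diag_mat s *v x"
      by (simp only: vec_eq_iff add_0_left sum_Basis_scaleR_nth)
        (simp add: c_def inner_axis diag_mat_mult_vector)
  qed
  have K: "(\<Prod>j\<in>Basis. \<bar>c j\<bar>) = (\<Prod>i\<in>UNIV. \<bar>s $ i\<bar>)"
    by (simp add: prod_Basis_vec c_def)
  show ?thesis
    using lborel_affine_euclidean[where c=c and t=0, OF c] unfolding T K .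
qed

lemma has_bochner_integral_orthogonal_diag_change:
  fixes U :: "real^('n::{finite,linorder})^('n::{finite,linorder})" and s :: "real^('n::{finite,linorder})"
  assumes U: "orthogonal_matrix U" and s: "\<And>i. s $ i > 0"
    and g[measurable]: "g \<in> borel_measurable borel"
  shows "has_bochner_integral lborel g I \<longleftrightarrow>
    has_bochner_integral lborel (\<lambda>y. (\<Prod>i\<in>UNIV. s $ i) * g ((U ** diag_mat s) *v y)) I"
proof -
  define K where "K = (\<Prod>i\<in>UNIV. s $ i)"
  have K: "K > 0" unfolding K_def using s by (simp add: prod_pos)
  have lborel_diag: "lborel = density (distr lborel borel ((*v) (diag_mat s))) (\<lambda>_. ennreal K)"
    using lborel_eq_density_distr_diag_mat[of s] s unfolding K_def
    by (simp add: less_imp_le less_imp_neq[symmetric])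
  have "has_bochner_integral lborel g I \<longleftrightarrow> has_bochner_integral (distr lborel borel ((*v) U)) g I"
    by (simp add: distr_lborel_orthogonal_matrix[OF U])
  also have "\<dots> \<longleftrightarrow> has_bochner_integral lborel (\<lambda>x. g (U *v x)) I"
    by (simp add: has_bochner_integral_iff integrable_distr_eq integral_distr)
  also have "\<dots> \<longleftrightarrow> has_bochner_integral
      (density (distr lborel borel ((*v) (diag_mat s))) (\<lambda>_. ennreal K)) (\<lambda>x. g (U *v x)) I"
    by (simp flip: lborel_diag)
  also have "\<dots> \<longleftrightarrow> has_bochner_integral (distr lborel borel ((*v) (diag_mat s)))
      (\<lambda>x. K *\<^sub>R g (U *v x)) I"
    using K by (simp add: has_bochner_integral_iff integrable_density integral_density)
  also have "\<dots> \<longleftrightarrow> has_bochner_integral lborel (\<lambda>y. K * g ((U ** diag_mat s) *v y)) I"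
    by (simp add: has_bochner_integral_iff integrable_distr_eq integral_distr matrix_vector_mul_assoc)
  finally show ?thesis by (simp add: K_def)
qed

lemma gauss_density_pos: "det S > 0 \<Longrightarrow> gauss_density S x > 0"
  by (simp add: gauss_density_def)

lemma borel_measurable_gauss_density [measurable]: "gauss_density S \<in> borel_measurable borel"
  unfolding gauss_density_def[abs_def] by measurable

lemma ln_gauss_density:
  fixes S :: "real^'n^'n"
  assumes "det S > 0"
  shows "ln (gauss_density S x)
    = - (x \<bullet> (matrix_inv S *v x)) / 2 - (CARD('n) * ln (2 * pi) + ln (det S)) / 2"
  using assms by (simp add: gauss_density_def ln_div ln_sqrt ln_mult ln_realpow algebra_simps)

lemma real_sqrt_prod: "sqrt (\<Prod>i\<in>S. f i) = (\<Prod>i\<in>S. sqrt (f i))"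
  by (induction S rule: infinite_finite_induct) (simp_all add: real_sqrt_mult)

lemma gauss_density_spectral_standardize:
  fixes U :: "real^'n^'n"
  assumes U: "orthogonal_matrix U" and d: "\<And>i. d $ i > 0"
    and A: "A = U ** diag_mat d ** transpose U" and s: "s = (\<chi> i. sqrt (d $ i))"
  shows "(\<Prod>i\<in>UNIV. s $ i) * gauss_density A ((U ** diag_mat s) *v y) = std_normal_vec_density y"
proof -
  have dnz: "d $ i \<noteq> 0" for i using d[of i] by simp
  have "(U ** diag_mat s) *v y = U *v (diag_mat s *v y)" by (simp add: matrix_vector_mul_assoc)
  then have "((U ** diag_mat s) *v y) \<bullet> (matrix_inv A *v ((U ** diag_mat s) *v y))
      = (diag_mat s *v y) \<bullet> (diag_mat (\<chi> i. 1 / d $ i) *v (diag_mat s *v y))"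
    by (simp add: A matrix_inv_spectral[OF U dnz] orthogonal_matrix_diag_quadratic[OF U])
  also have "\<dots> = y \<bullet> y"
    using d dnz by (simp add: s diag_mat_mult_vector inner_vec_def less_imp_le field_simps)
  finally have quad: "((U ** diag_mat s) *v y) \<bullet> (matrix_inv A *v ((U ** diag_mat s) *v y)) = y \<bullet> y" .
  have "sqrt ((2 * pi) ^ CARD('n) * det A) = sqrt (2 * pi) ^ CARD('n) * (\<Prod>i\<in>UNIV. s $ i)"
    using U d by (simp add: A s det_spectral real_sqrt_mult real_sqrt_power real_sqrt_prod power_mult_distrib)
  moreover have "(\<Prod>i\<in>UNIV. s $ i) > 0" using d by (simp add: s prod_pos)
  moreover have "s $ i \<noteq> 0" for i using d[of i] by (simp add: s)
  ultimately show ?thesis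
    by (simp add: gauss_density_def quad std_normal_vec_density_eq)
qed

lemma has_bochner_integral_gauss_density:
  fixes A :: "real^('n::{finite,linorder})^('n::{finite,linorder})"
  assumes A: "sym_posdef A"
  shows "has_bochner_integral lborel (gauss_density A) 1"
proof -
  obtain U d where U: "orthogonal_matrix U" "A = U ** diag_mat d ** transpose U"
    and d: "\<And>j. d $ j > 0"
    using sym_posdef_spectral[OF A] by blast
  define s :: "real^('n::{finite,linorder})" where "s = (\<chi> i. sqrt (d $ i))"
  have s: "s $ i > 0" for i using d by (simp add: s_def)
  show ?thesis
    unfolding has_bochner_integral_orthogonal_diag_change[OF U(1) s borel_measurable_gauss_density]
    by (simp add: gauss_density_spectral_standardize[OF U(1) d U(2) s_def] has_bochner_integral_std_normal_vec)
qed

lemma has_bochner_integral_gauss_density_quadratic: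
  fixes A M :: "real^('n::{finite,linorder})^('n::{finite,linorder})"
  assumes A: "sym_posdef A"
  shows "has_bochner_integral lborel (\<lambda>x. gauss_density A x * (x \<bullet> (M *v x))) (trace (M ** A))"
proof -
  obtain U d where U: "orthogonal_matrix U" "A = U ** diag_mat d ** transpose U"
    and d: "\<And>j. d $ j > 0"
    using sym_posdef_spectral[OF A] by blast
  define s :: "real^('n::{finite,linorder})" where "s = (\<chi> i. sqrt (d $ i))"
  have s: "s $ i > 0" for i using d by (simp add: s_def)
  define L where "L = U ** diag_mat s"
  have "L ** transpose L = U ** (diag_mat s ** diag_mat s) ** transpose U"
    by (simp add: L_def matrix_transpose_mul matrix_mul_assoc)
  also have "diag_mat s ** diag_mat s = diag_mat d"
    using d by (simp add: diag_mat_mult s_def less_imp_le vec_lambda_eta)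
  finally have LL: "L ** transpose L = A" using U(2) by simp
  have std: "(\<Prod>i\<in>UNIV. s $ i) * gauss_density A (L *v y) = std_normal_vec_density y" for y
    unfolding L_def by (rule gauss_density_spectral_standardize[OF U(1) d U(2) s_def])
  have quad: "(L *v y) \<bullet> (M *v (L *v y)) = y \<bullet> ((transpose L ** M ** L) *v y)" for y
  proof -
    have "(L *v y) \<bullet> (M *v (L *v y)) = y \<bullet> (transpose L *v (M *v (L *v y)))"
      using inner_matrix_vector_mult_transpose[of y "transpose L" "M *v (L *v y)"]
      by (simp del: transpose_matrix_vector)
    then show ?thesis by (simp add: matrix_vector_mul_assoc matrix_mul_assoc del: transpose_matrix_vector)
  qed
  have "has_bochner_integral lborel
      (\<lambda>y. (\<Prod>i\<in>UNIV. s $ i) * (gauss_density A (L *v y) * ((L *v y) \<bullet> (M *v (L *v y)))))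
      (trace (transpose L ** M ** L))"
    using has_bochner_integral_std_normal_vec_quadratic[of "transpose L ** M ** L"]
    by (simp only: mult.assoc[symmetric] std quad)
  moreover have "trace (transpose L ** M ** L) = trace (M ** A)"
    by (metis LL matrix_mul_assoc trace_mul_sym)
  ultimately show ?thesis
    by (subst has_bochner_integral_orthogonal_diag_change[OF U(1) s]) (simp_all add: L_def)
qed

section \<open>Kullback-Leibler divergence between centred Gaussians\<close>

lemma KL_gaussian:
  fixes A B :: "real^('n::{finite,linorder})^('n::{finite,linorder})"
  assumes A: "sym_posdef A" and B: "det B > 0"
  shows "KL (gaussian A) (gaussian B)
    = (trace (matrix_inv B ** A) - CARD('n) + ln (det B) - ln (det A)) / 2"
proof -
  have dA: "det A > 0" using sym_posdef_det_pos[OF A] .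
  define c where "c = (ln (det B) - ln (det A)) / 2"
  define Q where "Q = matrix_inv B - matrix_inv A"
  have "KL (gaussian A) (gaussian B) =
      (\<integral>x. gauss_density A x * log (exp 1) (gauss_density A x / gauss_density B x) \<partial>lborel)"
    unfolding KL_def gaussian_def
    by (rule lborel.KL_density_density)
      (auto simp: gauss_density_pos[OF B] gauss_density_pos[OF dA] less_imp_le less_imp_neq[symmetric])
  also have "\<dots> = (\<integral>x. (1/2) * (gauss_density A x * (x \<bullet> (Q *v x))) + c * gauss_density A x \<partial>lborel)"
  proof (rule Bochner_Integration.integral_cong[OF refl])
    fix x
    have "log (exp 1) (gauss_density A x / gauss_density B x)
        = ln (gauss_density A x) - ln (gauss_density B x)"
      using gauss_density_pos[OF B, of x] gauss_density_pos[OF dA, of x] by (simp add: log_def ln_div)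
    also have "\<dots> = (1/2) * (x \<bullet> (Q *v x)) + c"
      by (simp add: ln_gauss_density[OF B] ln_gauss_density[OF dA] c_def Q_def
          matrix_vector_mult_diff_rdistrib inner_diff_right field_simps)
    finally show "gauss_density A x * log (exp 1) (gauss_density A x / gauss_density B x)
        = (1/2) * (gauss_density A x * (x \<bullet> (Q *v x))) + c * gauss_density A x"
      by (simp add: algebra_simps)
  qed
  also have "\<dots> = (1/2) * trace (Q ** A) + c * 1"
    by (intro has_bochner_integral_integral_eq has_bochner_integral_add has_bochner_integral_mult_right
        has_bochner_integral_gauss_density_quadratic[OF A] has_bochner_integral_gauss_density[OF A])
  also have "trace (Q ** A) = trace (matrix_inv B ** A) - CARD('n)"
    using matrix_inv_left[of A] dA by (simp add: Q_def matrix_diff_rdistrib trace_sub trace_I)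
  finally show ?thesis by (simp add: c_def field_simps)
qed

lemma KL_gaussian_sqrt_diag:
  fixes A S :: "real^('n::{finite,linorder})^('n::{finite,linorder})"
  assumes A: "sym_posdef A" and SS: "S ** S = A" and d: "\<And>i. d $ i > 0"
  shows "KL (gaussian A) (gaussian (S ** diag_mat d ** S)) = (\<Sum>i\<in>UNIV. 1 / d $ i - 1 + ln (d $ i)) / 2"
proof -
  have dA: "det A > 0" using sym_posdef_det_pos[OF A] .
  have dAS: "det A = det S * det S" using SS by (metis det_mul)
  have dS: "det S \<noteq> 0" using dA dAS by auto
  have dnz: "d $ i \<noteq> 0" for i using d[of i] by simp
  have pd: "(\<Prod>i\<in>UNIV. d $ i) > 0" using d by (simp add: prod_pos)
  define B where "B = S ** diag_mat d ** S"
  define Di where "Di = diag_mat (\<chi> i. 1 / d $ i)"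
  have dB: "det B = det A * (\<Prod>i\<in>UNIV. d $ i)" by (simp add: B_def det_mul det_diag_mat dAS)
  have "det (diag_mat d) \<noteq> 0" using pd by (simp add: det_diag_mat dnz)
  then have "matrix_inv B = matrix_inv S ** (Di ** matrix_inv S)"
    using dS by (simp add: B_def Di_def matrix_inv_mult det_mul matrix_inv_diag_mat[OF dnz])
  then have "trace (matrix_inv B ** A) = trace (S ** (matrix_inv S ** Di))"
    by (metis SS dS matrix_inv_left matrix_mul_assoc matrix_mul_rid trace_mul_sym)
  also have "\<dots> = (\<Sum>i\<in>UNIV. 1 / d $ i)"
    using dS by (simp add: matrix_mul_assoc matrix_inv_right Di_def trace_def diag_mat_def)
  finally have "trace (matrix_inv B ** A) = (\<Sum>i\<in>UNIV. 1 / d $ i)" .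
  moreover have "ln (det B) - ln (det A) = (\<Sum>i\<in>UNIV. ln (d $ i))"
    using dA pd d by (simp add: dB ln_mult ln_prod less_imp_neq[symmetric])
  moreover have "det B > 0" using dA pd by (simp add: dB)
  ultimately show ?thesis
    using KL_gaussian[OF A, of B] by (simp add: B_def sum.distrib sum_subtractf algebra_simps)
qed

lemma card_rank_less:
  assumes "m \<le> CARD('n::{finite,linorder})"
  shows "card {i::'n. card {j. j < i} < m} = m"
proof -
  define r where "r i = card {j::'n. j < i}" for i
  have mono: "i < i' \<Longrightarrow> r i < r i'" for i i'
    unfolding r_def by (rule psubset_card_mono) auto
  then have inj: "inj r"
    by (metis injI less_irrefl linorder_neqE)
  have "r i < CARD('n)" for i
    unfolding r_def by (rule psubset_card_mono) auto
  then have "range r = {..<CARD('n)}"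
    using inj by (intro card_subset_eq) (auto simp: card_image)
  then have "r ` {i. r i < m} = {..<m}"
    using assms by (auto simp: image_iff)
  moreover have "card {i. r i < m} = card (r ` {i. r i < m})"
    using inj by (simp add: card_image inj_on_subset)
  ultimately show ?thesis by (simp add: r_def)
qed

lemma sum_D_mat_diag:
  fixes f :: "real \<Rightarrow> real"
  assumes "m \<le> CARD('n::{finite,linorder})"
  shows "(\<Sum>i\<in>(UNIV::'n set). f (if card {j. j < i} < m then a else b))
    = m * f a + (CARD('n) - m) * f b"
proof -
  let ?P = "{i::'n. card {j. j < i} < m}"
  have "(\<Sum>i\<in>(UNIV::'n set). f (if card {j. j < i} < m then a else b))
      = card ?P * f a + card (UNIV - ?P) * f b"
    by (simp add: if_distrib sum.If_cases Compl_eq_Diff_UNIV)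
  also have "card (UNIV - ?P) = CARD('n) - m"
    using card_rank_less[OF assms] by (simp add: card_Diff_subset)
  finally show ?thesis using card_rank_less[OF assms] by simp
qed

lemma KL_gaussian_D_mat:
  fixes \<Sigma> :: "real^('n::{finite,linorder})^('n::{finite,linorder})"
  assumes "sym_posdef \<Sigma>" "m \<le> CARD('n)" "0 < a" "0 < b"
  shows "KL (gaussian \<Sigma>) (gaussian (mat_sqrt \<Sigma> ** D_mat m a b ** mat_sqrt \<Sigma>))
    = (m * (1 / a - 1 + ln a) + (CARD('n) - m) * (1 / b - 1 + ln b)) / 2"
  using assms KL_gaussian_sqrt_diag[OF assms(1) mat_sqrt_mult_self[OF assms(1)],
      of "\<chi> i. if card {j. j < i} < m then a else b"]
    sum_D_mat_diag[OF assms(2), of "\<lambda>x. 1 / x - 1 + ln x" a b]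
  by (simp add: D_mat_def)

lemma scaleR_eq_mat_sqrt_D_mat:
  assumes "sym_posdef \<Sigma>"
  shows "\<sigma> *\<^sub>R \<Sigma> = mat_sqrt \<Sigma> ** D_mat m \<sigma> \<sigma> ** mat_sqrt \<Sigma>"
  by (simp add: D_mat_def diag_mat_const matrix_scalar_ac mat_sqrt_mult_self[OF assms]
      flip: scalar_matrix_assoc)

section \<open>The comparison\<close>

lemma ln_less_minus_one:
  fixes x :: real
  shows "0 < x \<Longrightarrow> x \<noteq> 1 \<Longrightarrow> ln x < x - 1"
  by (metis ln_eq_minus_one ln_le_minus_one order_less_le)

text \<open>Weighted AM-GM: with \<open>u = c / a\<close> and \<open>v = c / b\<close> the hypothesis reads
  \<open>m ln u + k ln v = 0\<close>, and \<open>ln x \<le> x - 1\<close>, strict unless \<open>x = 1\<close>, gives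
  \<open>0 < m (u - 1) + k (v - 1)\<close>.\<close>
lemma weighted_harmonic_mean_less:
  fixes a b c :: real and m k :: nat
  assumes "0 < a" "0 < b" "0 < c" "a \<noteq> b" "0 < m" "0 < k"
    and geometric: "a ^ m * b ^ k = c ^ (m + k)"
  shows "(m + k) / c < m / a + k / b"
proof -
  define u v where "u = c / a" and "v = c / b"
  have uv: "0 < u" "0 < v" "u \<noteq> 1 \<or> v \<noteq> 1"
    using assms by (auto simp: u_def v_def)
  have "m * ln a + k * ln b = (m + k) * ln c"
    using arg_cong[OF geometric, of ln] assms(1-3) by (simp add: ln_mult ln_realpow)
  then have "m * ln u + k * ln v = 0"
    using assms by (simp add: u_def v_def ln_div algebra_simps)
  moreover have "m * ln u \<le> m * (u - 1)" "k * ln v \<le> k * (v - 1)"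
    using uv ln_le_minus_one by (simp_all add: mult_left_mono)
  moreover have "m * ln u < m * (u - 1) \<or> k * ln v < k * (v - 1)"
    using uv assms ln_less_minus_one by auto
  ultimately have "m + k < m * u + k * v" by (auto simp: algebra_simps)
  then show ?thesis
    using assms by (simp add: u_def v_def divide_simps algebra_simps)
qed

lemma KL_gaussian_D_mat_constrained:
  fixes \<Sigma> :: "real^('n::{finite,linorder})^('n::{finite,linorder})"
  assumes "sym_posdef \<Sigma>" "m \<le> CARD('n)" "0 < a" "0 < b" "0 < \<sigma>"
    and "a ^ m * b ^ (CARD('n) - m) = \<sigma> ^ CARD('n)"
  shows "KL (gaussian \<Sigma>) (gaussian (mat_sqrt \<Sigma> ** D_mat m a b ** mat_sqrt \<Sigma>))
    = (m / a + (CARD('n) - m) / b - CARD('n) + CARD('n) * ln \<sigma>) / 2"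
proof -
  let ?n = "real CARD('n)"
  have ln: "m * ln a + (?n - m) * ln b = ?n * ln \<sigma>"
    using arg_cong[OF assms(6), of ln] assms(2-5) by (simp add: ln_mult ln_realpow of_nat_diff)
  have "m * (1 / a - 1 + ln a) + (?n - m) * (1 / b - 1 + ln b)
      = m / a + (?n - m) / b - ?n + (m * ln a + (?n - m) * ln b)"
    by (simp add: algebra_simps diff_divide_distrib)
  then show ?thesis
    using KL_gaussian_D_mat[OF assms(1-4)] assms(2) by (simp add: ln of_nat_diff)
qed

lemma KL_gaussian_scaleR:
  fixes \<Sigma> :: "real^('n::{finite,linorder})^('n::{finite,linorder})"
  assumes "sym_posdef \<Sigma>" "0 < \<sigma>"
  shows "KL (gaussian \<Sigma>) (gaussian (\<sigma> *\<^sub>R \<Sigma>)) = CARD('n) * (1 / \<sigma> - 1 + ln \<sigma>) / 2"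
  using KL_gaussian_D_mat[OF assms(1), of 0 \<sigma> \<sigma>] assms
  by (simp add: scaleR_eq_mat_sqrt_D_mat[OF assms(1), of _ 0])

lemma KL_gaussian_scaleR_pos:
  fixes \<Sigma> :: "real^('n::{finite,linorder})^('n::{finite,linorder})"
  assumes "sym_posdef \<Sigma>" "0 < \<sigma>" "\<sigma> \<noteq> 1"
  shows "KL (gaussian \<Sigma>) (gaussian (\<sigma> *\<^sub>R \<Sigma>)) > 0"
proof -
  have "ln (1 / \<sigma>) < 1 / \<sigma> - 1" using assms by (intro ln_less_minus_one) auto
  then show ?thesis using assms by (simp add: KL_gaussian_scaleR ln_div)
qed

lemma KL_gaussian_D_mat_gt_scaleR:
  fixes \<Sigma> :: "real^('n::{finite,linorder})^('n::{finite,linorder})"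
  assumes "sym_posdef \<Sigma>" "0 < m" "m < CARD('n)" "0 < \<sigma>"
    and "0 < \<alpha>" "0 < \<beta>" "\<alpha> \<noteq> \<beta>" "\<alpha> ^ m * \<beta> ^ (CARD('n) - m) = \<sigma> ^ CARD('n)"
  shows "KL (gaussian \<Sigma>) (gaussian (\<sigma> *\<^sub>R \<Sigma>))
    < KL (gaussian \<Sigma>) (gaussian (mat_sqrt \<Sigma> ** D_mat m \<alpha> \<beta> ** mat_sqrt \<Sigma>))"
proof -
  have "(m + (CARD('n) - m)) / \<sigma> < m / \<alpha> + (CARD('n) - m) / \<beta>"
    using assms by (intro weighted_harmonic_mean_less) simp_all
  then show ?thesis
    using assms by (simp add: KL_gaussian_scaleR KL_gaussian_D_mat_constrained of_nat_diff field_simps)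
qed

text \<open>Along the constraint curve the divergence is at least \<open>(n - m) / (2 * \<beta>)\<close> up to a constant.\<close>
lemma filterlim_KL_gaussian_D_mat_at_right_0:
  fixes \<Sigma> :: "real^('n::{finite,linorder})^('n::{finite,linorder})"
  assumes "sym_posdef \<Sigma>" "0 < m" "m < CARD('n)" "0 < \<sigma>"
  shows "filterlim (\<lambda>\<beta>. KL (gaussian \<Sigma>) (gaussian (mat_sqrt \<Sigma> **
      D_mat m (root m (\<sigma> ^ CARD('n) / \<beta> ^ (CARD('n) - m))) \<beta> ** mat_sqrt \<Sigma>))) at_top (at_right 0)"
proof (rule filterlim_at_top_mono)
  define k :: real where "k = CARD('n) - m"
  define C :: real where "C = (CARD('n) * ln \<sigma> - CARD('n)) / 2"
  have "k > 0" using assms by (simp add: k_def)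
  then have "filterlim (\<lambda>\<beta>. inverse \<beta> * (k / 2)) at_top (at_right 0)"
    by (intro filterlim_at_top_mult_tendsto_pos[OF tendsto_const] filterlim_inverse_at_top_right) simp
  then show "filterlim (\<lambda>\<beta>. C + inverse \<beta> * (k / 2)) at_top (at_right 0)"
    by (rule filterlim_tendsto_add_at_top[OF tendsto_const])
  show "\<forall>\<^sub>F \<beta> in at_right 0. C + inverse \<beta> * (k / 2) \<le> KL (gaussian \<Sigma>) (gaussian (mat_sqrt \<Sigma> **
      D_mat m (root m (\<sigma> ^ CARD('n) / \<beta> ^ (CARD('n) - m))) \<beta> ** mat_sqrt \<Sigma>))"
    using eventually_at_right_less[of 0]
  proof eventually_elim
    case (elim \<beta>)
    define \<alpha> where "\<alpha> = root m (\<sigma> ^ CARD('n) / \<beta> ^ (CARD('n) - m))"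
    have "0 < \<alpha>" "\<alpha> ^ m * \<beta> ^ (CARD('n) - m) = \<sigma> ^ CARD('n)"
      using elim assms by (simp_all add: \<alpha>_def real_root_pow_pos)
    then show ?case
      using elim assms
      by (simp add: \<alpha>_def[symmetric] KL_gaussian_D_mat_constrained k_def C_def field_simps)
  qed
qed

theorem propositionD2:
  fixes \<Sigma> :: "real^('n::{finite,linorder})^('n::{finite,linorder})" and m :: nat and \<sigma> :: real
  assumes "CARD('n) \<ge> 2" and "1 \<le> m" and "m \<le> CARD('n) - 1"
    and "0 < \<sigma>" and "\<sigma> < 1"
    and "sym_posdef \<Sigma>"
  shows "(\<forall>\<alpha> \<beta>. \<alpha> > \<beta> \<and> \<beta> > 0 \<and> \<alpha> ^ m * \<beta> ^ (CARD('n) - m) = \<sigma> ^ CARD('n) \<longrightarrow>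
            KL (gaussian \<Sigma>) (gaussian (mat_sqrt \<Sigma> ** D_mat m \<alpha> \<beta> ** mat_sqrt \<Sigma>))
              \<ge> KL (gaussian \<Sigma>) (gaussian (\<sigma> *\<^sub>R \<Sigma>))
          \<and> (KL (gaussian \<Sigma>) (gaussian (mat_sqrt \<Sigma> ** D_mat m \<alpha> \<beta> ** mat_sqrt \<Sigma>))
              = KL (gaussian \<Sigma>) (gaussian (\<sigma> *\<^sub>R \<Sigma>)) \<longleftrightarrow> \<alpha> = \<sigma> \<and> \<beta> = \<sigma>))
       \<and> filterlim
           (\<lambda>\<beta>. KL (gaussian \<Sigma>)
                   (gaussian (mat_sqrt \<Sigma> **
                      D_mat m (root m (\<sigma> ^ CARD('n) / \<beta> ^ (CARD('n) - m))) \<beta> ** mat_sqrt \<Sigma>))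
                 / KL (gaussian \<Sigma>) (gaussian (\<sigma> *\<^sub>R \<Sigma>)))
           at_top (at_right 0)"
proof -
  have m: "0 < m" "m < CARD('n)" using assms(1-3) by linarith+
  have "KL (gaussian \<Sigma>) (gaussian (\<sigma> *\<^sub>R \<Sigma>))
      < KL (gaussian \<Sigma>) (gaussian (mat_sqrt \<Sigma> ** D_mat m \<alpha> \<beta> ** mat_sqrt \<Sigma>))"
    if "\<alpha> > \<beta>" "\<beta> > 0" "\<alpha> ^ m * \<beta> ^ (CARD('n) - m) = \<sigma> ^ CARD('n)" for \<alpha> \<beta>
    using KL_gaussian_D_mat_gt_scaleR[OF assms(6) m assms(4)] that by simp
  moreover have "filterlim (\<lambda>\<beta>. KL (gaussian \<Sigma>) (gaussian (mat_sqrt \<Sigma> **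
      D_mat m (root m (\<sigma> ^ CARD('n) / \<beta> ^ (CARD('n) - m))) \<beta> ** mat_sqrt \<Sigma>))
      / KL (gaussian \<Sigma>) (gaussian (\<sigma> *\<^sub>R \<Sigma>))) at_top (at_right 0)"
  proof -
    have "0 < inverse (KL (gaussian \<Sigma>) (gaussian (\<sigma> *\<^sub>R \<Sigma>)))"
      using KL_gaussian_scaleR_pos[OF assms(6,4)] assms(5) by simp
    from filterlim_at_top_mult_tendsto_pos[OF tendsto_const this
        filterlim_KL_gaussian_D_mat_at_right_0[OF assms(6) m assms(4)]]
    show ?thesis by (simp add: divide_inverse)
  qed
  ultimately show ?thesis by force
qed

end
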